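(* The integrality gap of the standard LP relaxation of the restricted dominating set problem on circle graphs is bounded by $8$. That is, for every instance of the problem with demand chords $V^d$, covering chords $V^c$ and cost function $g:V^c\to\mathbb{Z}_{\ge 0}$ for which the linear program $$\min\Big\{\sum_{\beta\in V^c}g(\beta)z_\beta\ :\ z_\beta\ge 0\ \ \forall\beta\in V^c,\quad \sum_{\beta\in V^c:\ \beta\text{ intersects }\alpha}z_\beta\ge 1\ \ \forall \alpha\in V^d\Big\}$$ is feasible, the minimum cost of a set of covering chords that dominates all demand chords is at most $8$ times the optimal value of this linear program.
   Context: A circle graph is the intersection graph of a finite set of chords of a circle (two chords are adjacent if they intersect; chords sharing an endpoint intersect). In the restricted dominating set problem on circle graphs, a finite set of chords of a circle is given, partitioned into a set $V^d$ of demand chords and a set $V^c$ of covering chords, together with a cost function $g:V^c\to\mathbb{Z}_{\ge 0}$. A set $D\subseteq V^c$ dominates the demand chords if every $\alpha\in V^d$ is intersected by at least one $\beta\in D$. The goal is to find such a set $D$ of minimum cost $\sum_{\beta\in D}g(\beta)$. *)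

theory Defs
  imports "HOL-Analysis.Analysis"
begin

text \<open>The Euclidean plane is modelled by the complex numbers; a chord is the closed segment
  joining two distinct points of the circle.\<close>

definition chords :: "complex \<Rightarrow> real \<Rightarrow> complex set set" where
  "chords c r = {closed_segment a b |a b. a \<in> sphere c r \<and> b \<in> sphere c r \<and> a \<noteq> b}"

definition intersects :: "complex set \<Rightarrow> complex set \<Rightarrow> bool" where
  "intersects \<beta> \<alpha> \<longleftrightarrow> \<beta> \<inter> \<alpha> \<noteq> {}"

definition rds_instance :: "complex \<Rightarrow> real \<Rightarrow> complex set set \<Rightarrow> complex set set \<Rightarrow> bool" where
  "rds_instance c r Vd Vc \<longleftrightarrow>
     r > 0 \<and> finite (Vd \<union> Vc) \<and> Vd \<union> Vc \<subseteq> chords c r \<and> Vd \<inter> Vc = {}"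

definition dominating_sets :: "complex set set \<Rightarrow> complex set set \<Rightarrow> complex set set set" where
  "dominating_sets Vd Vc = {D. D \<subseteq> Vc \<and> (\<forall>\<alpha>\<in>Vd. \<exists>\<beta>\<in>D. intersects \<beta> \<alpha>)}"

definition rds_opt :: "complex set set \<Rightarrow> complex set set \<Rightarrow> (complex set \<Rightarrow> nat) \<Rightarrow> nat" where
  "rds_opt Vd Vc g = Min ((\<lambda>D. \<Sum>\<beta>\<in>D. g \<beta>) ` dominating_sets Vd Vc)"

definition lp_feasible :: "complex set set \<Rightarrow> complex set set \<Rightarrow> (complex set \<Rightarrow> real) set" where
  "lp_feasible Vd Vc =
     {z. (\<forall>\<beta>\<in>Vc. z \<beta> \<ge> 0) \<and> (\<forall>\<alpha>\<in>Vd. (\<Sum>\<beta>\<in>{\<beta>\<in>Vc. intersects \<beta> \<alpha>}. z \<beta>) \<ge> 1)}"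

definition lp_opt :: "complex set set \<Rightarrow> complex set set \<Rightarrow> (complex set \<Rightarrow> nat) \<Rightarrow> real" where
  "lp_opt Vd Vc g = (INF z\<in>lp_feasible Vd Vc. \<Sum>\<beta>\<in>Vc. real (g \<beta>) * z \<beta>)"

text \<open>On feasible instances, \<^const>\<open>rds_opt\<close> is the minimum of a nonempty finite set and
  \<^const>\<open>lp_opt\<close> is the infimum of a nonempty set that is bounded below, so neither
  takes an unspecified value.\<close>

lemma dominating_sets_nonempty:
  assumes "lp_feasible Vd Vc \<noteq> {}"
  shows "Vc \<in> dominating_sets Vd Vc"
proof -
  obtain z where z: "\<And>\<alpha>. \<alpha> \<in> Vd \<Longrightarrow> (\<Sum>\<beta>\<in>{\<beta>\<in>Vc. intersects \<beta> \<alpha>}. z \<beta>) \<ge> (1::real)"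
    using assms unfolding lp_feasible_def by blast
  have "\<exists>\<beta>\<in>Vc. intersects \<beta> \<alpha>" if "\<alpha> \<in> Vd" for \<alpha>
  proof (rule ccontr)
    assume "\<not> ?thesis"
    then have "{\<beta>\<in>Vc. intersects \<beta> \<alpha>} = {}" by blast
    with z[OF that] show False by (simp)
  qed
  then show ?thesis unfolding dominating_sets_def by blast
qed

lemma finite_dominating_sets:
  assumes "finite Vc"
  shows "finite (dominating_sets Vd Vc)"
  by (rule finite_subset[of _ "Pow Vc"]) (use assms in \<open>auto simp: dominating_sets_def\<close>)

lemma lp_objective_bdd_below:
  "bdd_below ((\<lambda>z. \<Sum>\<beta>\<in>Vc. real (g \<beta>) * z \<beta>) ` lp_feasible Vd Vc)"
  by (rule bdd_belowI2[where m = 0]) (auto simp: lp_feasible_def intro!: sum_nonneg)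

end

theory Submission imports Defs begin

text \<open>
  Cut the circle open at the direction where the argument jumps. A chord becomes a real interval,
  and two chords meet iff their intervals overlap without strict nesting, which means that one of
  them starts no later than the other, and ends inside it. So every covering interval that hits a
  demand interval $[a, b]$ does so from the left (its right end lies in $[a, b]$) or from the right.
  Given a feasible $z$, one of these two kinds carries at least half of the unit of $z$-weight that
  the demand sees. Hence $2z$ is fractionally feasible for two one-sided problems that together
  contain every demand (\<open>overlap_gap\<close>).

  A one-sided problem has integrality gap $2$ by a local-ratio argument (\<open>local_ratio\<close>): it
  suffices that some demand is hit at most twice by \<^emph>\<open>every\<close> inclusion-minimal cover. The demand
  with the smallest right end has this property (\<open>minimal_cover_overlap_left\<close>). Rounding the two
  sides separately and taking the union costs at most $2 \cdot 2 + 2 \cdot 2 = 8$ times the value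
  of $z$.

  The passage from chords to intervals (\<open>segments_meet_iff_overlap\<close>) rests on the product formula
  \<open>orient_circle\<close>: the side of a secant on which a point of the circle lies is determined by the
  order of the three arguments.
\<close>

section \<open>Local-ratio rounding of covering programs\<close>

definition covers :: "('b \<Rightarrow> 'a \<Rightarrow> bool) \<Rightarrow> 'b set \<Rightarrow> 'a set \<Rightarrow> bool" where
  "covers hit D A \<longleftrightarrow> (\<forall>\<alpha>\<in>A. \<exists>\<beta>\<in>D. hit \<beta> \<alpha>)"

definition minimal_cover :: "('b \<Rightarrow> 'a \<Rightarrow> bool) \<Rightarrow> 'b set \<Rightarrow> 'a set \<Rightarrow> bool" where
  "minimal_cover hit D A \<longleftrightarrow> covers hit D A \<and> (\<forall>\<beta>\<in>D. \<not> covers hit (D - {\<beta>}) A)"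

lemma minimal_cover_private:
  assumes "minimal_cover hit D A" "\<beta> \<in> D"
  obtains \<alpha> where "\<alpha> \<in> A" "hit \<beta> \<alpha>" "\<And>\<beta>'. \<beta>' \<in> D \<Longrightarrow> \<beta>' \<noteq> \<beta> \<Longrightarrow> \<not> hit \<beta>' \<alpha>"
  using assms unfolding minimal_cover_def covers_def by blast

text \<open>A cover of the demands that \<open>\<beta>\<close> misses stays minimal when \<open>\<beta>\<close> is added only if needed:
  the private demands of the old members are all missed by \<open>\<beta>\<close>.\<close>

lemma minimal_cover_extend:
  assumes D: "minimal_cover hit D {\<alpha>\<in>A. \<not> hit \<beta> \<alpha>}" and "\<beta> \<notin> D"
  obtains D' where "D' = D \<or> D' = insert \<beta> D" "minimal_cover hit D' A"
proof (cases "covers hit D A")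
  case True
  with D have "minimal_cover hit D A"
    unfolding minimal_cover_def covers_def by blast
  with that show ?thesis by blast
next
  case False
  have "\<not> covers hit (insert \<beta> D - {\<gamma>}) A" if "\<gamma> \<in> insert \<beta> D" for \<gamma>
  proof (cases "\<gamma> = \<beta>")
    case True
    with \<open>\<beta> \<notin> D\<close> False show ?thesis by simp
  next
    case False
    with that have "\<gamma> \<in> D" by simp
    with D obtain \<alpha> where "\<alpha> \<in> A" "\<not> hit \<beta> \<alpha>"
      "\<And>\<beta>'. \<beta>' \<in> D \<Longrightarrow> \<beta>' \<noteq> \<gamma> \<Longrightarrow> \<not> hit \<beta>' \<alpha>"
      by (elim minimal_cover_private) auto
    then show ?thesis unfolding covers_def by blast
  qed
  moreover have "covers hit (insert \<beta> D) A"
    using D unfolding minimal_cover_def covers_def by blast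
  ultimately have "minimal_cover hit (insert \<beta> D) A"
    unfolding minimal_cover_def by blast
  with that show ?thesis by blast
qed

text \<open>Both recursive steps keep the cover minimal. An element of weight zero is free, so the demands
  that it hits can be dropped. If all weights are positive, lower them by the same \<open>\<epsilon>\<close> on the
  elements that hit the special demand \<open>\<alpha>\<close> until one of them becomes free: a minimal cover then pays
  at most \<open>k * \<epsilon>\<close> for the lowered part, while \<open>z\<close> pays at least \<open>\<epsilon>\<close>. The assumption speaks of
  minimal covers since arbitrary covers may hit \<open>\<alpha>\<close> often; it is required for all subsets of
  demands since demands disappear during the recursion.\<close>

lemma local_ratio:
  fixes hit :: "'b \<Rightarrow> 'a \<Rightarrow> bool" and w z :: "'b \<Rightarrow> real"
  assumes "finite B"
    and "\<And>\<beta>. \<beta> \<in> B \<Longrightarrow> w \<beta> \<ge> 0" and "\<And>\<beta>. \<beta> \<in> B \<Longrightarrow> z \<beta> \<ge> 0"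
    and "\<And>\<alpha>. \<alpha> \<in> A \<Longrightarrow> (\<Sum>\<beta>\<in>{\<beta>\<in>B. hit \<beta> \<alpha>}. z \<beta>) \<ge> 1"
    and "\<And>A' :: 'a set. A' \<subseteq> A \<Longrightarrow> A' \<noteq> {} \<Longrightarrow>
      \<exists>\<alpha>\<in>A'. \<forall>D\<subseteq>B. minimal_cover hit D A' \<longrightarrow> card {\<beta>\<in>D. hit \<beta> \<alpha>} \<le> k"
  shows "\<exists>D\<subseteq>B. minimal_cover hit D A \<and> (\<Sum>\<beta>\<in>D. w \<beta>) \<le> real k * (\<Sum>\<beta>\<in>B. w \<beta> * z \<beta>)"
  using assms
proof (induction "card B + card {\<beta>\<in>B. w \<beta> > 0}" arbitrary: B A w rule: less_induct)
  case less
  note fin = less.prems(1) and w0 = less.prems(2) and z0 = less.prems(3)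
    and cov = less.prems(4) and few = less.prems(5)
  consider (empty) "A = {}" | (free) \<beta> where "\<beta> \<in> B" "w \<beta> = 0"
    | (pos) "A \<noteq> {}" "\<And>\<beta>. \<beta> \<in> B \<Longrightarrow> w \<beta> > 0"
    using w0 by force
  then show ?case
  proof cases
    case empty
    have "0 \<le> real k * (\<Sum>\<beta>\<in>B. w \<beta> * z \<beta>)"
      using w0 z0 by (intro mult_nonneg_nonneg sum_nonneg) auto
    with empty show ?thesis
      by (intro exI[of _ "{}"]) (auto simp: minimal_cover_def covers_def)
  next
    case free
    define A' where "A' = {\<alpha>\<in>A. \<not> hit \<beta> \<alpha>}"
    have 1: "card (B - {\<beta>}) + card {x \<in> B - {\<beta>}. w x > 0} < card B + card {x\<in>B. w x > 0}"
      using fin free(1) by (intro add_less_le_mono card_mono card_Diff1_less) auto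
    have 2: "(\<Sum>x\<in>{x\<in>B - {\<beta>}. hit x \<alpha>}. z x) \<ge> 1" if "\<alpha> \<in> A'" for \<alpha>
    proof -
      have "{x\<in>B - {\<beta>}. hit x \<alpha>} = {x\<in>B. hit x \<alpha>}" using that by (auto simp: A'_def)
      then show ?thesis using cov[of \<alpha>] that by (simp add: A'_def)
    qed
    have 3: "\<exists>\<alpha>\<in>A''. \<forall>D\<subseteq>B - {\<beta>}. minimal_cover hit D A'' \<longrightarrow> card {x\<in>D. hit x \<alpha>} \<le> k"
      if "A'' \<subseteq> A'" "A'' \<noteq> {}" for A''
    proof -
      have "A'' \<subseteq> A" using that(1) by (auto simp: A'_def)
      from few[OF this that(2)] show ?thesis by blast
    qed
    obtain D where D: "D \<subseteq> B - {\<beta>}" "minimal_cover hit D A'"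
      "sum w D \<le> real k * (\<Sum>x\<in>B - {\<beta>}. w x * z x)"
    proof -
      have "\<exists>D\<subseteq>B - {\<beta>}. minimal_cover hit D A' \<and>
          sum w D \<le> real k * (\<Sum>x\<in>B - {\<beta>}. w x * z x)"
      proof (rule less.hyps[OF 1])
        show "finite (B - {\<beta>})" using fin by simp
        show "w x \<ge> 0" "z x \<ge> 0" if "x \<in> B - {\<beta>}" for x using w0 z0 that by auto
      qed (fact 2, fact 3)
      then show thesis using that by blast
    qed
    have "\<beta> \<notin> D" using D(1) by blast
    obtain D' where D': "D' = D \<or> D' = insert \<beta> D" "minimal_cover hit D' A"
      using minimal_cover_extend[OF D(2)[unfolded A'_def] \<open>\<beta> \<notin> D\<close>] by blast
    have "finite D" using D(1) fin finite_subset by blast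
    then have "sum w D' = sum w D" using D'(1) \<open>\<beta> \<notin> D\<close> free(2) by auto
    moreover have "(\<Sum>x\<in>B - {\<beta>}. w x * z x) = (\<Sum>x\<in>B. w x * z x)"
      using sum.remove[OF fin free(1), of "\<lambda>x. w x * z x"] free(2) by simp
    ultimately show ?thesis
      using D D' free(1) by (intro exI[of _ D']) auto
  next
    case pos
    obtain \<alpha> where \<alpha>: "\<alpha> \<in> A"
      "\<And>D. D \<subseteq> B \<Longrightarrow> minimal_cover hit D A \<Longrightarrow> card {\<beta>\<in>D. hit \<beta> \<alpha>} \<le> k"
      using few[of A] pos(1) by auto
    define H where "H = {\<beta>\<in>B. hit \<beta> \<alpha>}"
    have finH: "finite H" using fin by (simp add: H_def)
    have "H \<noteq> {}" using cov[OF \<alpha>(1)] by (auto simp: H_def[symmetric])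
    define \<epsilon> where "\<epsilon> = Min (w ` H)"
    obtain \<beta>0 where \<beta>0: "\<beta>0 \<in> H" "w \<beta>0 = \<epsilon>"
      using Min_in[of "w ` H"] finH \<open>H \<noteq> {}\<close> unfolding \<epsilon>_def image_iff by fastforce
    have le: "\<epsilon> \<le> w \<beta>" if "\<beta> \<in> H" for \<beta> using finH that by (simp add: \<epsilon>_def)
    have "\<epsilon> > 0" using \<beta>0 pos(2) by (auto simp: H_def)
    define w' where "w' = (\<lambda>\<beta>. w \<beta> - (if \<beta> \<in> H then \<epsilon> else 0))"
    have "{x\<in>B. w' x > 0} \<subset> {x\<in>B. w x > 0}"
    proof
      show "{x\<in>B. w' x > 0} \<subseteq> {x\<in>B. w x > 0}" using pos(2) by auto
      show "{x\<in>B. w' x > 0} \<noteq> {x\<in>B. w x > 0}"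
        using \<beta>0 \<open>\<epsilon> > 0\<close> by (auto simp: w'_def H_def)
    qed
    then have 1: "card B + card {x\<in>B. w' x > 0} < card B + card {x\<in>B. w x > 0}"
      using fin by (simp add: psubset_card_mono)
    have 2: "w' x \<ge> 0" if "x \<in> B" for x using le[of x] w0[OF that] by (simp add: w'_def)
    obtain D where D: "D \<subseteq> B" "minimal_cover hit D A"
      "sum w' D \<le> real k * (\<Sum>x\<in>B. w' x * z x)"
      using less.hyps[OF 1 fin 2 z0 cov few] by metis
    have finD: "finite D" using D(1) fin finite_subset by blast
    have DH: "D \<inter> H = {\<beta>\<in>D. hit \<beta> \<alpha>}" using D(1) by (auto simp: H_def)
    have "sum w D = sum w' D + (\<Sum>x\<in>D. if x \<in> H then \<epsilon> else 0)"
      by (simp add: w'_def sum_subtractf)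
    also have "(\<Sum>x\<in>D. if x \<in> H then \<epsilon> else 0) = \<epsilon> * real (card (D \<inter> H))"
      using finD by (simp add: sum.inter_restrict[symmetric])
    also have "\<dots> \<le> \<epsilon> * real k"
      using \<alpha>(2)[OF D(1,2)] \<open>\<epsilon> > 0\<close> DH by simp
    also have "\<dots> \<le> \<epsilon> * real k * sum z H"
      using mult_left_mono[OF cov[OF \<alpha>(1)], of "\<epsilon> * real k"] \<open>\<epsilon> > 0\<close> by (simp add: H_def)
    also have "\<epsilon> * real k * sum z H = real k * (\<Sum>x\<in>B. (if x \<in> H then \<epsilon> else 0) * z x)"
    proof -
      have "(\<Sum>x\<in>B. (if x \<in> H then \<epsilon> else 0) * z x) = (\<Sum>x\<in>B. if x \<in> H then \<epsilon> * z x else 0)"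
        by (rule sum.cong) auto
      also have "\<dots> = (\<Sum>x\<in>B \<inter> H. \<epsilon> * z x)" using fin by (simp add: sum.inter_restrict)
      also have "B \<inter> H = H" by (auto simp: H_def)
      finally show ?thesis by (simp add: sum_distrib_left mult_ac)
    qed
    finally have "sum w D \<le> real k * (\<Sum>x\<in>B. w' x * z x)
        + real k * (\<Sum>x\<in>B. (if x \<in> H then \<epsilon> else 0) * z x)"
      using D(3) by simp
    also have "\<dots> = real k * (\<Sum>x\<in>B. w x * z x)"
      by (simp add: w'_def left_diff_distrib sum_subtractf right_diff_distrib)
    finally show ?thesis using D by blast
  qed
qed

section \<open>One-sided overlap of intervals\<close>

lemma card_le_2_if_no_sorted_triple:
  fixes f :: "'b \<Rightarrow> real"
  assumes "\<And>x y z. {x, y, z} \<subseteq> K \<Longrightarrow> distinct [x, y, z] \<Longrightarrow> f x \<le> f y \<Longrightarrow> f y \<le> f z \<Longrightarrow> False"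
  shows "card K \<le> 2"
proof (rule ccontr)
  assume "\<not> card K \<le> 2"
  then obtain T where "T \<subseteq> K" "card T = 3"
    by (metis not_less_eq_eq numeral_2_eq_2 numeral_3_eq_3 obtain_subset_with_card_n)
  then obtain x y z where "{x, y, z} \<subseteq> K" "x \<noteq> y" "x \<noteq> z" "y \<noteq> z"
    by (auto simp: card_3_iff)
  then show False
    using assms[of x y z] assms[of x z y] assms[of y x z] assms[of y z x] assms[of z x y]
      assms[of z y x] linear[of "f x" "f y"] linear[of "f y" "f z"] linear[of "f x" "f z"]
    by auto
qed

text \<open>Pairs stand for closed intervals. All inequalities are weak since chords that share an endpoint
  intersect.\<close>

definition overlap_left :: "real \<times> real \<Rightarrow> real \<times> real \<Rightarrow> bool" where
  "overlap_left J I \<longleftrightarrow> fst J \<le> fst I \<and> fst I \<le> snd J \<and> snd J \<le> snd I"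

text \<open>Suppose that three members \<open>x\<close>, \<open>y\<close>, \<open>z\<close> of the cover, sorted by their right ends, hit the
  demand \<open>\<alpha>\<close> from the left, and let \<open>s\<close>, \<open>t\<close> be private demands of \<open>x\<close>, \<open>y\<close>. No demand ends before
  \<open>\<alpha>\<close>, so \<open>s\<close> can avoid \<open>y\<close> only by starting before \<open>y\<close> starts, and likewise \<open>t\<close> starts before
  \<open>z\<close>. Thus \<open>x\<close>, \<open>s\<close>, \<open>y\<close>, \<open>t\<close>, \<open>z\<close>, \<open>\<alpha>\<close> start in this order, so \<open>t\<close> starts after \<open>x\<close> starts and,
  starting before \<open>\<alpha>\<close>, before \<open>x\<close> ends. Then \<open>x\<close> hits \<open>t\<close>, which was private to \<open>y\<close>.\<close>

lemma minimal_cover_overlap_left: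
  fixes p :: "'a \<Rightarrow> real \<times> real" and q :: "'b \<Rightarrow> real \<times> real"
  assumes D: "minimal_cover (\<lambda>\<beta> \<alpha>. overlap_left (q \<beta>) (p \<alpha>)) D A"
    and first: "\<And>\<alpha>'. \<alpha>' \<in> A \<Longrightarrow> snd (p \<alpha>) \<le> snd (p \<alpha>')"
  shows "card {\<beta>\<in>D. overlap_left (q \<beta>) (p \<alpha>)} \<le> 2"
proof (rule card_le_2_if_no_sorted_triple[where f = "\<lambda>\<beta>. snd (q \<beta>)"])
  fix x y z
  assume K: "{x, y, z} \<subseteq> {\<beta>\<in>D. overlap_left (q \<beta>) (p \<alpha>)}" and dist: "distinct [x, y, z]"
    and sorted: "snd (q x) \<le> snd (q y)" "snd (q y) \<le> snd (q z)"
  obtain s where s: "s \<in> A" "overlap_left (q x) (p s)" "\<not> overlap_left (q y) (p s)"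
    using minimal_cover_private[OF D, of x] K dist
    by (metis (no_types, lifting) distinct_length_2_or_more insert_subset mem_Collect_eq)
  obtain t where t: "t \<in> A" "overlap_left (q y) (p t)"
      "\<not> overlap_left (q x) (p t)" "\<not> overlap_left (q z) (p t)"
    using minimal_cover_private[OF D, of y] K dist
    by (metis (no_types, lifting) distinct_length_2_or_more insert_subset mem_Collect_eq)
  show False
  proof -
    have K': "overlap_left (q v) (p \<alpha>)" if "v \<in> {x, y, z}" for v using K that by blast
    note ineqs = K'[of x] K'[of y] K'[of z] s(2) t(2) first[OF s(1)] first[OF t(1)] sorted
    have "fst (p s) < fst (q y)" using ineqs s(3) by (simp add: overlap_left_def; linarith)
    moreover have "fst (p t) < fst (q z)" using ineqs t(4) by (simp add: overlap_left_def; linarith)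
    ultimately have "overlap_left (q x) (p t)"
      using ineqs unfolding overlap_left_def by simp
    with t(3) show False by contradiction
  qed
qed

lemma overlap_left_gap:
  fixes p :: "'a \<Rightarrow> real \<times> real" and q :: "'b \<Rightarrow> real \<times> real" and w z :: "'b \<Rightarrow> real"
  assumes "finite A" "finite B"
    and "\<And>\<beta>. \<beta> \<in> B \<Longrightarrow> w \<beta> \<ge> 0" and "\<And>\<beta>. \<beta> \<in> B \<Longrightarrow> z \<beta> \<ge> 0"
    and "\<And>\<alpha>. \<alpha> \<in> A \<Longrightarrow> (\<Sum>\<beta>\<in>{\<beta>\<in>B. overlap_left (q \<beta>) (p \<alpha>)}. z \<beta>) \<ge> 1"
  obtains D where "D \<subseteq> B" "covers (\<lambda>\<beta> \<alpha>. overlap_left (q \<beta>) (p \<alpha>)) D A"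
    "(\<Sum>\<beta>\<in>D. w \<beta>) \<le> 2 * (\<Sum>\<beta>\<in>B. w \<beta> * z \<beta>)"
proof -
  let ?hit = "\<lambda>\<beta> \<alpha>. overlap_left (q \<beta>) (p \<alpha>)"
  have few: "\<exists>\<alpha>\<in>A'. \<forall>D\<subseteq>B. minimal_cover ?hit D A' \<longrightarrow> card {\<beta>\<in>D. ?hit \<beta> \<alpha>} \<le> 2"
    if "A' \<subseteq> A" "A' \<noteq> {}" for A'
  proof -
    have "finite A'" using that \<open>finite A\<close> finite_subset by blast
    then obtain \<alpha> where "\<alpha> \<in> A'" "\<And>\<alpha>'. \<alpha>' \<in> A' \<Longrightarrow> snd (p \<alpha>) \<le> snd (p \<alpha>')"
      using arg_min_if_finite[of A' "\<lambda>\<alpha>. snd (p \<alpha>)"] \<open>A' \<noteq> {}\<close> by (meson not_less)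
    then show ?thesis
      by (intro bexI[of _ \<alpha>] allI impI minimal_cover_overlap_left[where A = A'])
  qed
  have "\<exists>D\<subseteq>B. minimal_cover ?hit D A \<and> sum w D \<le> real 2 * (\<Sum>\<beta>\<in>B. w \<beta> * z \<beta>)"
    by (rule local_ratio[where z = z]) (fact assms few)+
  then show ?thesis using that by (auto simp: minimal_cover_def)
qed

section \<open>Two-sided overlap of intervals\<close>

lemma overlap_gap:
  fixes p :: "'a \<Rightarrow> real \<times> real" and q :: "'b \<Rightarrow> real \<times> real" and w z :: "'b \<Rightarrow> real"
  assumes fin: "finite A" "finite B"
    and w0: "\<And>\<beta>. \<beta> \<in> B \<Longrightarrow> w \<beta> \<ge> 0" and z0: "\<And>\<beta>. \<beta> \<in> B \<Longrightarrow> z \<beta> \<ge> 0"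
    and hit: "\<And>\<alpha> \<beta>. \<alpha> \<in> A \<Longrightarrow> \<beta> \<in> B \<Longrightarrow>
      hit \<beta> \<alpha> \<longleftrightarrow> overlap_left (q \<beta>) (p \<alpha>) \<or> overlap_left (p \<alpha>) (q \<beta>)"
    and cov: "\<And>\<alpha>. \<alpha> \<in> A \<Longrightarrow> (\<Sum>\<beta>\<in>{\<beta>\<in>B. hit \<beta> \<alpha>}. z \<beta>) \<ge> 1"
  obtains D where "D \<subseteq> B" "covers hit D A" "(\<Sum>\<beta>\<in>D. w \<beta>) \<le> 8 * (\<Sum>\<beta>\<in>B. w \<beta> * z \<beta>)"
proof -
  \<comment> \<open>Reflecting the line turns hits from the right into hits from the left.\<close>
  define flip where "flip = (\<lambda>I :: real \<times> real. (- snd I, - fst I))"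
  have flip: "overlap_left (flip J) (flip I) \<longleftrightarrow> overlap_left I J" for I J
    by (auto simp: flip_def overlap_left_def)
  define L where "L = (\<lambda>\<alpha>. {\<beta>\<in>B. overlap_left (q \<beta>) (p \<alpha>)})"
  define R where "R = (\<lambda>\<alpha>. {\<beta>\<in>B. overlap_left (p \<alpha>) (q \<beta>)})"
  define AL where "AL = {\<alpha>\<in>A. sum z (L \<alpha>) \<ge> 1/2}"
  define AR where "AR = {\<alpha>\<in>A. sum z (R \<alpha>) \<ge> 1/2}"
  have split: "A \<subseteq> AL \<union> AR"
  proof
    fix \<alpha> assume "\<alpha> \<in> A"
    have "{\<beta>\<in>B. hit \<beta> \<alpha>} = L \<alpha> \<union> R \<alpha>"
      using hit[OF \<open>\<alpha> \<in> A\<close>] by (auto simp: L_def R_def)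
    then have "1 \<le> sum z (L \<alpha> \<union> R \<alpha>)" using cov[OF \<open>\<alpha> \<in> A\<close>] by simp
    also have "\<dots> \<le> sum z (L \<alpha>) + sum z (R \<alpha>)"
    proof -
      have "sum z (L \<alpha> \<inter> R \<alpha>) \<ge> 0" using z0 by (intro sum_nonneg) (auto simp: L_def)
      then show ?thesis using sum.union_inter[of "L \<alpha>" "R \<alpha>" z] fin by (simp add: L_def R_def)
    qed
    finally show "\<alpha> \<in> AL \<union> AR" using \<open>\<alpha> \<in> A\<close> by (auto simp: AL_def AR_def)
  qed
  have "finite AL" "finite AR" using fin by (auto simp: AL_def AR_def)
  obtain DL where DL: "DL \<subseteq> B" "covers (\<lambda>\<beta> \<alpha>. overlap_left (q \<beta>) (p \<alpha>)) DL AL"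
    "sum w DL \<le> 2 * (\<Sum>\<beta>\<in>B. w \<beta> * (2 * z \<beta>))"
  proof (rule overlap_left_gap[where A = AL and B = B and w = w and z = "\<lambda>\<beta>. 2 * z \<beta>"])
    show "(\<Sum>\<beta>\<in>{\<beta>\<in>B. overlap_left (q \<beta>) (p \<alpha>)}. 2 * z \<beta>) \<ge> 1" if "\<alpha> \<in> AL" for \<alpha>
      using that by (simp add: AL_def L_def sum_distrib_left[symmetric])
  qed (use fin w0 z0 \<open>finite AL\<close> in auto)
  obtain DR where DR: "DR \<subseteq> B"
    "covers (\<lambda>\<beta> \<alpha>. overlap_left (flip (q \<beta>)) (flip (p \<alpha>))) DR AR"
    "sum w DR \<le> 2 * (\<Sum>\<beta>\<in>B. w \<beta> * (2 * z \<beta>))"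
  proof (rule overlap_left_gap[where A = AR and B = B and w = w and z = "\<lambda>\<beta>. 2 * z \<beta>"
        and p = "\<lambda>\<alpha>. flip (p \<alpha>)" and q = "\<lambda>\<beta>. flip (q \<beta>)"])
    show "(\<Sum>\<beta>\<in>{\<beta>\<in>B. overlap_left (flip (q \<beta>)) (flip (p \<alpha>))}. 2 * z \<beta>) \<ge> 1" if "\<alpha> \<in> AR" for \<alpha>
      using that by (simp add: AR_def R_def flip sum_distrib_left[symmetric])
  qed (use fin w0 z0 \<open>finite AR\<close> in auto)
  have cover: "covers hit (DL \<union> DR) A"
    unfolding covers_def
  proof
    fix \<alpha> assume "\<alpha> \<in> A"
    then consider "\<alpha> \<in> AL" | "\<alpha> \<in> AR" using split by blast
    then show "\<exists>\<beta>\<in>DL \<union> DR. hit \<beta> \<alpha>"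
    proof cases
      case 1
      with DL(2) obtain \<beta> where "\<beta> \<in> DL" "overlap_left (q \<beta>) (p \<alpha>)"
        by (auto simp: covers_def)
      then show ?thesis using hit[OF \<open>\<alpha> \<in> A\<close>] DL(1) by blast
    next
      case 2
      with DR(2) obtain \<beta> where "\<beta> \<in> DR" "overlap_left (p \<alpha>) (q \<beta>)"
        by (auto simp: covers_def flip)
      then show ?thesis using hit[OF \<open>\<alpha> \<in> A\<close>] DR(1) by blast
    qed
  qed
  have "sum w (DL \<inter> DR) \<ge> 0" using w0 DL(1) by (intro sum_nonneg) auto
  moreover have "finite DL" "finite DR" using DL(1) DR(1) fin(2) finite_subset by blast+
  ultimately have "sum w (DL \<union> DR) \<le> sum w DL + sum w DR"
    using sum.union_inter[of DL DR w] by simp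
  also have "\<dots> \<le> 8 * (\<Sum>\<beta>\<in>B. w \<beta> * z \<beta>)"
    
  proof -
    have "(\<Sum>\<beta>\<in>B. w \<beta> * (2 * z \<beta>)) = 2 * (\<Sum>\<beta>\<in>B. w \<beta> * z \<beta>)"
      unfolding sum_distrib_left by (rule sum.cong) auto
    then show ?thesis using DL(3) DR(3) by linarith
  qed
  finally show ?thesis using that[of "DL \<union> DR"] DL(1) DR(1) cover by blast
qed

section \<open>Chords as intervals\<close>

text \<open>Twice the signed area of the triangle \<open>a\<close>, \<open>b\<close>, \<open>x\<close>; as a function of \<open>x\<close> it is affine and
  vanishes on the line through \<open>a\<close> and \<open>b\<close>.\<close>

definition orient :: "complex \<Rightarrow> complex \<Rightarrow> complex \<Rightarrow> real" where
  "orient a b x = Im (cnj (b - a) * (x - a))"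

lemma orient_swap: "orient b a x = - orient a b x"
  by (simp add: orient_def algebra_simps)

lemma orient_zero_on_segment:
  assumes "x \<in> closed_segment a b"
  shows "orient a b x = 0"
proof -
  obtain u where "x = (1 - u) *\<^sub>R a + u *\<^sub>R b" using assms by (auto simp: in_segment)
  then have "x - a = u *\<^sub>R (b - a)" by (simp add: algebra_simps)
  then show ?thesis by (simp add: orient_def) (simp add: algebra_simps)
qed

lemma segment_orient_pos:
  assumes "orient a b x > 0" "orient a b y > 0"
  shows "closed_segment a b \<inter> closed_segment x y = {}"
proof (rule ccontr)
  assume "closed_segment a b \<inter> closed_segment x y \<noteq> {}"
  then obtain m where m: "m \<in> closed_segment a b" "m \<in> closed_segment x y" by blast
  obtain u where u: "m = (1 - u) *\<^sub>R x + u *\<^sub>R y" "0 \<le> u" "u \<le> 1"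
    using m(2) by (auto simp: in_segment)
  have "orient a b m = (1 - u) * orient a b x + u * orient a b y"
    by (simp add: u(1) orient_def algebra_simps)
  also have "\<dots> > 0"
    using assms u by (cases "u = 0") (auto intro!: add_nonneg_pos)
  finally show False using orient_zero_on_segment[OF m(1)] by simp
qed

text \<open>Four points of the plane satisfy one affine dependency, whose coefficients are the four signed
  areas. Under the sign assumptions it equates a convex combination of \<open>a\<close>, \<open>b\<close> with one of \<open>x\<close>,
  \<open>y\<close>, up to the common total weight \<open>s\<close>.\<close>

lemma segments_cross:
  assumes "orient a b x < 0" "orient a b y > 0" "orient x y a > 0" "orient x y b < 0"
  shows "closed_segment a b \<inter> closed_segment x y \<noteq> {}"
proof -
  define s where "s = orient a b y - orient a b x"
  have s: "s > 0" "s = orient x y a - orient x y b"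
    using assms by (auto simp: s_def orient_def algebra_simps)
  define m where "m = (1 - orient x y a / s) *\<^sub>R a + (orient x y a / s) *\<^sub>R b"
  have sm: "s *\<^sub>R m = (- orient x y b) *\<^sub>R a + orient x y a *\<^sub>R b"
    using s by (simp add: m_def scaleR_add_right right_diff_distrib)
  also have "\<dots> = orient a b y *\<^sub>R x + (- orient a b x) *\<^sub>R y"
    by (simp add: complex_eq_iff orient_def algebra_simps)
  also have "\<dots> = s *\<^sub>R ((1 - (- orient a b x / s)) *\<^sub>R x + (- orient a b x / s) *\<^sub>R y)"
  proof -
    have "s * (1 - (- orient a b x / s)) = orient a b y" "s * (- orient a b x / s) = - orient a b x"
      using s(1) by (auto simp: distrib_left) (simp add: s_def)
    then show ?thesis by (simp only: scaleR_add_right scaleR_scaleR)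
  qed
  finally have m': "m = (1 - (- orient a b x / s)) *\<^sub>R x + (- orient a b x / s) *\<^sub>R y"
    using s(1) by simp
  have "m \<in> closed_segment a b"
    unfolding in_segment using s assms m_def by (intro exI[of _ "orient x y a / s"]) auto
  moreover have "m \<in> closed_segment x y"
    unfolding in_segment using s(1) assms m'
    by (intro exI[of _ "- orient a b x / s"]) (auto simp: s_def field_simps)
  ultimately show ?thesis by blast
qed

lemma sin_triangle:
  "sin (2 * x) + sin (2 * y) - sin (2 * x + 2 * y) = 4 * sin x * sin y * sin (x + y)" for x y :: real
proof -
  have "sin (2 * x) + sin (2 * y) - sin (2 * x + 2 * y)
    = sin (2 * x) * (1 - cos (2 * y)) + sin (2 * y) * (1 - cos (2 * x))"
    by (simp add: sin_add algebra_simps)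
  also have "\<dots> = 4 * sin x * sin y * sin (x + y)"
    by (simp only: sin_double cos_double_sin sin_add) (simp add: algebra_simps power2_eq_square)
  finally show ?thesis .
qed

lemma orient_circle:
  fixes r s t u :: real and c :: complex
  shows "orient (c + r *\<^sub>R cis s) (c + r *\<^sub>R cis t) (c + r *\<^sub>R cis u) =
    4 * r\<^sup>2 * (sin ((t - s) / 2) * sin ((u - t) / 2) * sin ((u - s) / 2))"
proof -
  have "orient (c + r *\<^sub>R cis s) (c + r *\<^sub>R cis t) (c + r *\<^sub>R cis u)
    = r\<^sup>2 * (sin (t - s) + sin (u - t) - sin (u - s))"
    by (simp add: orient_def sin_diff algebra_simps power2_eq_square)
  also have "sin (t - s) + sin (u - t) - sin (u - s) =
     4 * sin ((t - s) / 2) * sin ((u - t) / 2) * sin ((u - s) / 2)"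
  proof -
    have "2 * ((t - s) / 2) = t - s" "2 * ((u - t) / 2) = u - t"
      "t - s + (u - t) = u - s" "(t - s) / 2 + (u - t) / 2 = (u - s) / 2"
      by (simp_all add: field_simps)
    then show ?thesis using sin_triangle[of "(t - s) / 2" "(u - t) / 2"] by (simp only:)
  qed
  finally show ?thesis by simp
qed

text \<open>Halving brings differences of arguments into the interval from \<open>-pi\<close> to \<open>pi\<close>, where the sine
  has the sign of its argument.\<close>

lemma sgn_sin_half_diff:
  fixes s t :: real
  assumes "\<bar>t - s\<bar> < 2 * pi"
  shows "sgn (sin ((t - s) / 2)) = sgn (t - s)"
proof -
  consider "t = s" | "t - s > 0" | "s - t > 0" by linarith
  then show ?thesis
  proof cases
    case 2
    then have "sin ((t - s) / 2) > 0" using assms by (intro sin_gt_zero) auto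
    with 2 show ?thesis by simp
  next
    case 3
    then have "sin ((s - t) / 2) > 0" using assms by (intro sin_gt_zero) auto
    moreover have "sin ((t - s) / 2) = - sin ((s - t) / 2)"
      by (metis minus_diff_eq minus_divide_left sin_minus)
    ultimately show ?thesis using 3 by simp
  qed simp
qed

lemma orient_sphere:
  assumes "r > 0" "a \<in> sphere c r" "b \<in> sphere c r" "x \<in> sphere c r"
  shows "sgn (orient a b x) = sgn (Arg (b - c) - Arg (a - c)) *
    sgn (Arg (x - c) - Arg (b - c)) * sgn (Arg (x - c) - Arg (a - c))"
proof -
  have polar: "y = c + r *\<^sub>R cis (Arg (y - c))" if "y \<in> sphere c r" for y
  proof -
    have "cmod (y - c) = r" using that by (simp add: dist_norm norm_minus_commute)
    then show ?thesis using rcis_cmod_Arg[of "y - c"] by (simp add: rcis_def scaleR_conv_of_real)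
  qed
  have half: "sgn (sin ((Arg (y' - c) - Arg (y - c)) / 2)) = sgn (Arg (y' - c) - Arg (y - c))" for y y'
    using Arg_bounded[of "y - c"] Arg_bounded[of "y' - c"]
    by (intro sgn_sin_half_diff) linarith+
  have "orient a b x = 4 * r\<^sup>2 * (sin ((Arg (b - c) - Arg (a - c)) / 2)
      * sin ((Arg (x - c) - Arg (b - c)) / 2) * sin ((Arg (x - c) - Arg (a - c)) / 2))"
    using orient_circle[of c r "Arg (a - c)" "Arg (b - c)" "Arg (x - c)"] polar assms by simp
  then show ?thesis using \<open>r > 0\<close> by (simp add: sgn_mult half)
qed

lemma Arg_inj_on_sphere: "inj_on (\<lambda>x. Arg (x - c)) (sphere c r)"
proof (rule inj_onI)
  fix x y assume "x \<in> sphere c r" "y \<in> sphere c r" and eq: "Arg (x - c) = Arg (y - c)"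
  then have "cmod (x - c) = cmod (y - c)" by (simp add: dist_norm norm_minus_commute)
  with eq have "x - c = y - c" by (metis rcis_cmod_Arg)
  then show "x = y" by simp
qed

text \<open>Seen from the chord \<open>a b\<close>, the points with arguments strictly between those of \<open>a\<close> and \<open>b\<close>
  lie strictly on one side, and the remaining ones other than \<open>a\<close>, \<open>b\<close> strictly on the other.
  Without overlap, \<open>x\<close> and \<open>y\<close> lie on the same side. With overlap, either an endpoint is shared or
  each chord strictly separates the endpoints of the other.\<close>

lemma segments_meet_iff_overlap:
  assumes "r > 0" and S: "a \<in> sphere c r" "b \<in> sphere c r" "x \<in> sphere c r" "y \<in> sphere c r"
  defines "\<theta> \<equiv> \<lambda>v. Arg (v - c)"
  assumes ab: "\<theta> a < \<theta> b" and xy: "\<theta> x < \<theta> y"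
  shows "closed_segment a b \<inter> closed_segment x y \<noteq> {} \<longleftrightarrow>
    overlap_left (\<theta> a, \<theta> b) (\<theta> x, \<theta> y) \<or> overlap_left (\<theta> x, \<theta> y) (\<theta> a, \<theta> b)"
proof -
  have o: "sgn (orient u v w) = sgn (\<theta> v - \<theta> u) * sgn (\<theta> w - \<theta> v) * sgn (\<theta> w - \<theta> u)"
    if "u \<in> sphere c r" "v \<in> sphere c r" "w \<in> sphere c r" for u v w
    unfolding \<theta>_def using orient_sphere[OF \<open>r > 0\<close> that] .
  have pos: "orient u v w > 0"
    if "\<theta> u < \<theta> v" "\<theta> w < \<theta> u \<or> \<theta> v < \<theta> w" "u \<in> sphere c r" "v \<in> sphere c r" "w \<in> sphere c r" for u v w
  proof -
    have "sgn (orient u v w) = 1" using o[OF that(3-5)] that(1,2) by (auto simp: sgn_if)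
    then show ?thesis by (simp add: sgn_1_pos)
  qed
  have neg: "orient u v w < 0"
    if "\<theta> u < \<theta> w" "\<theta> w < \<theta> v" "u \<in> sphere c r" "v \<in> sphere c r" "w \<in> sphere c r" for u v w
  proof -
    have "sgn (orient u v w) = -1" using o[OF that(3-5)] that(1,2) by (auto simp: sgn_if)
    then show ?thesis by (simp add: sgn_1_neg)
  qed
  have cross: "closed_segment a b \<inter> closed_segment x y \<noteq> {}"
    if "\<theta> a \<le> \<theta> x" "\<theta> x \<le> \<theta> b" "\<theta> b \<le> \<theta> y" "\<theta> a < \<theta> b" "\<theta> x < \<theta> y"
      "a \<in> sphere c r" "b \<in> sphere c r" "x \<in> sphere c r" "y \<in> sphere c r" for a b x y
  proof (cases "\<theta> a = \<theta> x \<or> \<theta> x = \<theta> b \<or> \<theta> b = \<theta> y")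
    case True
    then have "a = x \<or> x = b \<or> b = y"
      using Arg_inj_on_sphere[of c r] that(6-9) by (auto simp: \<theta>_def inj_on_def)
    then show ?thesis by auto
  next
    case False
    then show ?thesis using that by (intro segments_cross pos neg) auto
  qed
  show ?thesis
  proof
    assume "overlap_left (\<theta> a, \<theta> b) (\<theta> x, \<theta> y) \<or> overlap_left (\<theta> x, \<theta> y) (\<theta> a, \<theta> b)"
    then show "closed_segment a b \<inter> closed_segment x y \<noteq> {}"
      using cross[of a x b y] cross[of x a y b] ab xy S by (auto simp: overlap_left_def Int_commute)
  next
    assume meet: "closed_segment a b \<inter> closed_segment x y \<noteq> {}"
    show "overlap_left (\<theta> a, \<theta> b) (\<theta> x, \<theta> y) \<or> overlap_left (\<theta> x, \<theta> y) (\<theta> a, \<theta> b)"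
    proof (rule ccontr)
      assume "\<not> ?thesis"
      then have "\<not> (\<theta> a \<le> \<theta> x \<and> \<theta> x \<le> \<theta> b \<and> \<theta> b \<le> \<theta> y)"
        "\<not> (\<theta> x \<le> \<theta> a \<and> \<theta> a \<le> \<theta> y \<and> \<theta> y \<le> \<theta> b)"
        by (simp_all add: overlap_left_def)
      then consider "\<theta> a < \<theta> x" "\<theta> y < \<theta> b"
        | "\<theta> x < \<theta> a \<or> \<theta> b < \<theta> x" "\<theta> y < \<theta> a \<or> \<theta> b < \<theta> y"
        using ab xy by linarith
      then show False
      proof cases
        case 1
        then have "orient a b x < 0" "orient a b y < 0"
          using neg[of a x b] neg[of a y b] xy S by auto
        then have "orient b a x > 0" "orient b a y > 0"
          using orient_swap[of b a] by simp_all
        then show False using segment_orient_pos[of b a x y] meet by (simp add: closed_segment_commute)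
      next
        case 2
        then have "orient a b x > 0" "orient a b y > 0" using pos ab S by auto
        then show False using segment_orient_pos[of a b x y] meet by simp
      qed
    qed
  qed
qed

lemma chords_as_intervals:
  assumes "r > 0"
  obtains I :: "complex set \<Rightarrow> real \<times> real"
  where "\<And>\<alpha> \<beta>. \<alpha> \<in> chords c r \<Longrightarrow> \<beta> \<in> chords c r \<Longrightarrow>
    intersects \<beta> \<alpha> \<longleftrightarrow> overlap_left (I \<beta>) (I \<alpha>) \<or> overlap_left (I \<alpha>) (I \<beta>)"
proof -
  define \<theta> where "\<theta> = (\<lambda>v. Arg (v - c))"
  have "\<exists>a b. \<gamma> = closed_segment a b \<and> a \<in> sphere c r \<and> b \<in> sphere c r \<and> \<theta> a < \<theta> b"
    if "\<gamma> \<in> chords c r" for \<gamma>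
  proof -
    obtain a b where ab: "\<gamma> = closed_segment a b" "a \<in> sphere c r" "b \<in> sphere c r" "a \<noteq> b"
      using \<open>\<gamma> \<in> chords c r\<close> unfolding chords_def by blast
    then have "\<theta> a \<noteq> \<theta> b" using Arg_inj_on_sphere[of c r] by (auto simp: \<theta>_def inj_on_def)
    then consider "\<theta> a < \<theta> b" | "\<theta> b < \<theta> a" by linarith
    then show ?thesis using ab closed_segment_commute[of a b] by cases metis+
  qed
  then obtain f h where fh: "\<And>\<gamma>. \<gamma> \<in> chords c r \<Longrightarrow> \<gamma> = closed_segment (f \<gamma>) (h \<gamma>) \<and>
      f \<gamma> \<in> sphere c r \<and> h \<gamma> \<in> sphere c r \<and> \<theta> (f \<gamma>) < \<theta> (h \<gamma>)"
    by metis
  show ?thesis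
  proof (rule that[of "\<lambda>\<gamma>. (\<theta> (f \<gamma>), \<theta> (h \<gamma>))"])
    fix \<alpha> \<beta> assume "\<alpha> \<in> chords c r" "\<beta> \<in> chords c r"
    note \<alpha> = fh[OF this(1)] and \<beta> = fh[OF this(2)]
    have "intersects \<beta> \<alpha> \<longleftrightarrow> closed_segment (f \<beta>) (h \<beta>) \<inter> closed_segment (f \<alpha>) (h \<alpha>) \<noteq> {}"
      using \<alpha> \<beta> by (simp add: intersects_def)
    also have "\<dots> \<longleftrightarrow> overlap_left (\<theta> (f \<beta>), \<theta> (h \<beta>)) (\<theta> (f \<alpha>), \<theta> (h \<alpha>)) \<or>
        overlap_left (\<theta> (f \<alpha>), \<theta> (h \<alpha>)) (\<theta> (f \<beta>), \<theta> (h \<beta>))"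
      using \<alpha> \<beta> \<open>r > 0\<close> unfolding \<theta>_def by (intro segments_meet_iff_overlap) auto
    finally show "intersects \<beta> \<alpha> \<longleftrightarrow> \<dots>" .
  qed
qed

section \<open>The integrality gap\<close>

theorem claim1:
  fixes c :: complex and r :: real
    and Vd Vc :: "complex set set"
    and g :: "complex set \<Rightarrow> nat"
  assumes "rds_instance c r Vd Vc"
    and "lp_feasible Vd Vc \<noteq> {}"
  shows "real (rds_opt Vd Vc g) \<le> 8 * lp_opt Vd Vc g"
proof -
  have r: "r > 0" and fin: "finite Vd" "finite Vc" and ch: "Vd \<subseteq> chords c r" "Vc \<subseteq> chords c r"
    using assms(1) by (auto simp: rds_instance_def)
  obtain I :: "complex set \<Rightarrow> real \<times> real" where
    I: "\<And>\<alpha> \<beta>. \<alpha> \<in> chords c r \<Longrightarrow> \<beta> \<in> chords c r \<Longrightarrow>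
      intersects \<beta> \<alpha> \<longleftrightarrow> overlap_left (I \<beta>) (I \<alpha>) \<or> overlap_left (I \<alpha>) (I \<beta>)"
    using chords_as_intervals[OF r] by blast
  have "real (rds_opt Vd Vc g) / 8 \<le> (\<Sum>\<beta>\<in>Vc. real (g \<beta>) * z \<beta>)"
    if z: "z \<in> lp_feasible Vd Vc" for z
  proof -
    obtain D where D: "D \<subseteq> Vc" "covers intersects D Vd"
      "(\<Sum>\<beta>\<in>D. real (g \<beta>)) \<le> 8 * (\<Sum>\<beta>\<in>Vc. real (g \<beta>) * z \<beta>)"
    proof (rule overlap_gap[where p = I and q = I and hit = intersects and A = Vd and B = Vc
          and w = "\<lambda>\<beta>. real (g \<beta>)" and z = z])
      show "intersects \<beta> \<alpha> \<longleftrightarrow> overlap_left (I \<beta>) (I \<alpha>) \<or> overlap_left (I \<alpha>) (I \<beta>)"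
        if "\<alpha> \<in> Vd" "\<beta> \<in> Vc" for \<alpha> \<beta>
        using I ch that by blast
    qed (use fin z in \<open>auto simp: lp_feasible_def\<close>)
    then have "D \<in> dominating_sets Vd Vc" by (auto simp: dominating_sets_def covers_def)
    then have "rds_opt Vd Vc g \<le> (\<Sum>\<beta>\<in>D. g \<beta>)"
      unfolding rds_opt_def using finite_dominating_sets[OF fin(2)] by (intro Min_le) auto
    then have "real (rds_opt Vd Vc g) \<le> (\<Sum>\<beta>\<in>D. real (g \<beta>))"
      by (metis of_nat_le_iff of_nat_sum)
    with D(3) show ?thesis by simp
  qed
  then have "real (rds_opt Vd Vc g) / 8 \<le> lp_opt Vd Vc g"
    unfolding lp_opt_def using assms(2) by (intro cINF_greatest)
  then show ?thesis by simp
qed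

end
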